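(* Let $f$ be the target probability density on $\mathbb{R}^d$, let $\alpha\in[0,1]$, and let $(\eta_{k,\alpha})_{k\ge1}$ be the sequence of adaptive regularization parameters defined for all $k\ge1$ by $$\eta_{k,\alpha}=1-\frac{D_\alpha(\mathbb{P}_k\|\mathbb{Q}_k)}{\log(m_k)},$$ where $m_k$, $D_\alpha$, $\mathbb{P}_k$ and $\mathbb{Q}_k$ are defined in the context. Then: (i) The sequence $(\eta_{k,\alpha})_{k\ge1}$ is valued in $[0,1]$, with $\eta_{k,\alpha}=1$ if and only if $\mathbb{P}_k=\mathbb{Q}_k$. (ii) $0\le\eta_{k,1}\le\eta_{k,\alpha}\le1$ (for all $k\ge1$). (iii) Further assume that $(q_k)_{k\ge1}$ is a sequence of probability density functions such that $\lim_{k\to\infty}|q_k(x)-f(x)|=0$ almost everywhere, and that $\lim_{k\to\infty}m_k=m$. Then $\lim_{k\to\infty}\eta_{k,\alpha}=1$ in $L_1$, i.e. $\lim_{k\to\infty}\mathbb{E}[|\eta_{k,\alpha}-1|]=0$.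
   Context: Densities are with respect to Lebesgue measure on $\mathbb{R}^d$. The densities $(q_k)_{k\ge0}$ are the successive proposal (sampling) densities of an adaptive importance sampling scheme, and $m_k$ is the batch size at time $k$ (an integer, $m_k\ge2$ so that $\log(m_k)\neq0$; $m$ in (iii) is finite). At each time $k\ge1$, a batch of $m_k$ i.i.d. samples $X_{k,1},\dots,X_{k,m_k}$ is generated from $q_{k-1}$, and the associated normalized importance weights are $W_{k,\ell}\propto f(X_{k,\ell})/q_{k-1}(X_{k,\ell})$ for $\ell=1,\dots,m_k$, with $\sum_{\ell=1}^{m_k}W_{k,\ell}=1$ (it is implicit that the unnormalized weights are not all zero). The reweighted and uniform distributions on the sampled points are $$\mathbb{P}_k=\sum_{\ell=1}^{m_k}W_{k,\ell}\,\delta_{X_{k,\ell}},\qquad \mathbb{Q}_k=\sum_{\ell=1}^{m_k}\frac1{m_k}\,\delta_{X_{k,\ell}}.$$ Rényi's $\alpha$-divergence of $\mathbb{P}_k$ from $\mathbb{Q}_k$ is defined for $\alpha\in\mathbb{R}\setminus\{0,1\}$ by $$D_\alpha(\mathbb{P}_k\|\mathbb{Q}_k)=\frac1{\alpha-1}\log\Big(\sum_{\ell=1}^{m_k}W_{k,\ell}^\alpha\, m_k^{\alpha-1}\Big).$$ It is extended by continuity to the forward Kullback-Leibler divergence by letting $\alpha\to1$, denoted $D_1(\mathbb{P}_k\|\mathbb{Q}_k)=\sum_{\ell=1}^{m_k}W_{k,\ell}\log(m_kW_{k,\ell})$, and to what the authors call the reverse Kullback-Leibler divergence by letting $\alpha\to0$,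 denoted $D_0(\mathbb{P}_k\|\mathbb{Q}_k)$.
   Formalization: For α=0, with D_0 the limit of D_α as α→0, only "P_k=Q_k implies η_{k,0}=1" is proved in (i); the converse is dropped because it is false (m_k=2 with weights 1/3, 2/3 gives D_0=0, so η_{k,0}=1, but P_k≠Q_k). *)

theory Defs
  imports "HOL-Probability.Probability"
begin

definition prob_density :: "(real ^ 'd \<Rightarrow> real) \<Rightarrow> bool" where
  "prob_density g \<longleftrightarrow>
     g \<in> borel_measurable borel \<and> (\<forall>x. 0 \<le> g x) \<and> (\<integral>\<^sup>+x. ennreal (g x) \<partial>lborel) = 1"

(* The sample X k l and the proposal density q k may depend on the outcome \<omega>, because the scheme
   is adaptive. Where q (k - 1) vanishes at a sample (a null event for samples drawn from
   q (k - 1)), division by zero makes the weight 0. *)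

definition unnormalized_weight ::
  "(real ^ 'd \<Rightarrow> real) \<Rightarrow> (nat \<Rightarrow> 'w \<Rightarrow> real ^ 'd \<Rightarrow> real) \<Rightarrow> (nat \<Rightarrow> nat \<Rightarrow> 'w \<Rightarrow> real ^ 'd) \<Rightarrow>
   nat \<Rightarrow> nat \<Rightarrow> 'w \<Rightarrow> real" where
  "unnormalized_weight f q X k l \<omega> = f (X k l \<omega>) / q (k - 1) \<omega> (X k l \<omega>)"

definition weights_defined ::
  "(real ^ 'd \<Rightarrow> real) \<Rightarrow> (nat \<Rightarrow> 'w \<Rightarrow> real ^ 'd \<Rightarrow> real) \<Rightarrow> (nat \<Rightarrow> nat) \<Rightarrow>
   (nat \<Rightarrow> nat \<Rightarrow> 'w \<Rightarrow> real ^ 'd) \<Rightarrow> nat \<Rightarrow> 'w \<Rightarrow> bool" where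
  "weights_defined f q m X k \<omega> \<longleftrightarrow> (\<exists>l\<in>{1..m k}. unnormalized_weight f q X k l \<omega> \<noteq> 0)"

definition weight ::
  "(real ^ 'd \<Rightarrow> real) \<Rightarrow> (nat \<Rightarrow> 'w \<Rightarrow> real ^ 'd \<Rightarrow> real) \<Rightarrow> (nat \<Rightarrow> nat) \<Rightarrow>
   (nat \<Rightarrow> nat \<Rightarrow> 'w \<Rightarrow> real ^ 'd) \<Rightarrow> nat \<Rightarrow> nat \<Rightarrow> 'w \<Rightarrow> real" where
  "weight f q m X k l \<omega> =
     unnormalized_weight f q X k l \<omega> / (\<Sum>j=1..m k. unnormalized_weight f q X k j \<omega>)"

(* The image of the measure with masses w l on {1..n} under l \<mapsto> x l, i.e. the sum of the Dirac
   masses w l * \<delta>_(x l); the points x l need not be distinct. *)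

definition weighted_diracs :: "nat \<Rightarrow> (nat \<Rightarrow> real) \<Rightarrow> (nat \<Rightarrow> real ^ 'd) \<Rightarrow> (real ^ 'd) measure" where
  "weighted_diracs n w x = distr (point_measure {1..n} (\<lambda>l. ennreal (w l))) borel x"

definition reweighted_dist ::
  "(real ^ 'd \<Rightarrow> real) \<Rightarrow> (nat \<Rightarrow> 'w \<Rightarrow> real ^ 'd \<Rightarrow> real) \<Rightarrow> (nat \<Rightarrow> nat) \<Rightarrow>
   (nat \<Rightarrow> nat \<Rightarrow> 'w \<Rightarrow> real ^ 'd) \<Rightarrow> nat \<Rightarrow> 'w \<Rightarrow> (real ^ 'd) measure" where
  "reweighted_dist f q m X k \<omega> =
     weighted_diracs (m k) (\<lambda>l. weight f q m X k l \<omega>) (\<lambda>l. X k l \<omega>)"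

definition uniform_dist ::
  "(nat \<Rightarrow> nat) \<Rightarrow> (nat \<Rightarrow> nat \<Rightarrow> 'w \<Rightarrow> real ^ 'd) \<Rightarrow> nat \<Rightarrow> 'w \<Rightarrow> (real ^ 'd) measure" where
  "uniform_dist m X k \<omega> = weighted_diracs (m k) (\<lambda>l. 1 / real (m k)) (\<lambda>l. X k l \<omega>)"

(* Renyi's divergence of the weights w 1, ..., w n from the uniform weights 1 / n, for \<alpha> outside
   {0, 1}. *)

definition renyi_formula :: "real \<Rightarrow> nat \<Rightarrow> (nat \<Rightarrow> real) \<Rightarrow> real" where
  "renyi_formula \<alpha> n w = 1 / (\<alpha> - 1) * ln (\<Sum>l=1..n. w l powr \<alpha> * real n powr (\<alpha> - 1))"

(* Order 1 is the forward Kullback-Leibler divergence, where w * ln (n * w) is 0 for w = 0. Order 0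
   is the extension by continuity; the limit is from the right since a negative power of a zero
   weight is infinite, whereas 0 powr \<alpha> = 0. *)

definition renyi_div :: "real \<Rightarrow> nat \<Rightarrow> (nat \<Rightarrow> real) \<Rightarrow> real" where
  "renyi_div \<alpha> n w =
     (if \<alpha> = 1 then \<Sum>l=1..n. w l * ln (real n * w l)
      else if \<alpha> = 0 then Lim (at_right 0) (\<lambda>a. renyi_formula a n w)
      else renyi_formula \<alpha> n w)"

definition reg_param ::
  "(real ^ 'd \<Rightarrow> real) \<Rightarrow> (nat \<Rightarrow> 'w \<Rightarrow> real ^ 'd \<Rightarrow> real) \<Rightarrow> (nat \<Rightarrow> nat) \<Rightarrow>
   (nat \<Rightarrow> nat \<Rightarrow> 'w \<Rightarrow> real ^ 'd) \<Rightarrow> nat \<Rightarrow> real \<Rightarrow> 'w \<Rightarrow> real" where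
  "reg_param f q m X k \<alpha> \<omega> =
     1 - renyi_div \<alpha> (m k) (\<lambda>l. weight f q m X k l \<omega>) / ln (real (m k))"

(* F k is the information available after batch k. The assumption "batch" says that, conditionally
   on F (k - 1), the samples X k 1, ..., X k (m k) are i.i.d. with density q (k - 1). For
   deterministic proposals q this is an ordinary i.i.d. batch, independent of the past. *)

locale adaptive_importance_sampling =
  prob_space M + filtration "space M" F
  for M :: "'w measure" and F :: "nat \<Rightarrow> 'w measure" +
  fixes f :: "real ^ 'd \<Rightarrow> real"
    and q :: "nat \<Rightarrow> 'w \<Rightarrow> real ^ 'd \<Rightarrow> real"
    and m :: "nat \<Rightarrow> nat"
    and X :: "nat \<Rightarrow> nat \<Rightarrow> 'w \<Rightarrow> real ^ 'd"
  assumes subalgebra_F: "subalgebra M (F k)"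
    and target: "prob_density f"
    and batch_size: "k \<ge> 1 \<Longrightarrow> m k \<ge> 2"
    and proposal_density: "\<omega> \<in> space M \<Longrightarrow> prob_density (q k \<omega>)"
    and proposal_adapted: "(\<lambda>(\<omega>, x). q k \<omega> x) \<in> borel_measurable (F k \<Otimes>\<^sub>M borel)"
    and sample_adapted: "k \<ge> 1 \<Longrightarrow> l \<in> {1..m k} \<Longrightarrow> X k l \<in> borel_measurable (F k)"
    and batch:
      "k \<ge> 1 \<Longrightarrow> A \<in> sets (F (k - 1)) \<Longrightarrow> (\<And>l. l \<in> {1..m k} \<Longrightarrow> B l \<in> sets borel) \<Longrightarrow>
       emeasure M {\<omega> \<in> A. \<forall>l\<in>{1..m k}. X k l \<omega> \<in> B l} =
       (\<integral>\<^sup>+\<omega>\<in>A. (\<Prod>l=1..m k. \<integral>\<^sup>+x\<in>B l. ennreal (q (k - 1) \<omega> x) \<partial>lborel) \<partial>M)"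
    and weights_nonzero: "AE \<omega> in M. \<forall>k\<ge>1. weights_defined f q m X k \<omega>"

end

theory Submission
  imports Defs
begin

text \<open>
  For fixed weights, Jensen's inequality gives \<open>0 \<le> D\<^sub>\<alpha> \<le> D\<^sub>1 \<le> ln n\<close>, and the equality cases come from
  strict concavity of \<open>t powr \<alpha>\<close> and of the logarithm. For the convergence, the joint law of the past
  and one sample of batch \<open>k\<close> has density \<open>q (k - 1)\<close>, so by Markov's inequality the probability that an
  unnormalized weight \<open>f / q (k - 1)\<close> differs from 1 by more than \<open>e\<close> is at most the expected
  \<open>L\<^sub>1\<close> distance of \<open>q (k - 1)\<close> and \<open>f\<close> divided by \<open>e\<close>. Scheffe's lemma on the product space sends this to 0;
  on the complementary event all weights are nearly uniform and \<open>D\<^sub>1\<close> is small, and \<open>D\<^sub>\<alpha> / ln n \<le> 1\<close> otherwise.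
\<close>

section \<open>Tangent inequalities for powers and the logarithm, with equality cases\<close>

text \<open>With \<open>c = t powr a\<close>, the bound \<open>ln x \<le> x - 1\<close> is applied
  at \<open>t / c\<close> with weight \<open>a\<close> and at \<open>1 / c\<close> with weight
  \<open>1 - a\<close>. The logarithms cancel, leaving the tangent inequality divided by
  \<open>c\<close>. Equality must then hold in both bounds, which forces
  \<open>c = 1\<close>.\<close>

lemma powr_le_tangent:
  fixes t a :: real
  assumes "0 \<le> t" "0 < a" "a < 1"
  shows "t powr a \<le> 1 + a * (t - 1)"
    and "t powr a = 1 + a * (t - 1) \<Longrightarrow> t = 1"
proof -
  have "t powr a \<le> 1 + a * (t - 1) \<and> (t powr a = 1 + a * (t - 1) \<longrightarrow> t = 1)"
  proof (cases "t = 0")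
    case True
    then show ?thesis using assms by auto
  next
    case False
    then have t: "t > 0" using assms by simp
    define c where "c = t powr a"
    have c: "c > 0" using t by (simp add: c_def)
    have lnc: "ln c = a * ln t" using t by (simp add: c_def ln_powr)
    have A: "a * ln (t / c) \<le> a * (t / c - 1)"
      using assms t c by (intro mult_left_mono ln_le_minus_one) auto
    have B: "(1 - a) * ln (1 / c) \<le> (1 - a) * (1 / c - 1)"
      using assms c by (intro mult_left_mono ln_le_minus_one) auto
    have AB: "a * ln (t / c) + (1 - a) * ln (1 / c) = 0"
      using t c lnc by (simp add: ln_div algebra_simps)
    have rhs: "a * (t / c - 1) + (1 - a) * (1 / c - 1) = (1 + a * (t - 1)) / c - 1"
      using c by (simp add: field_simps)
    have "c \<le> 1 + a * (t - 1)"
    proof -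
      have "1 \<le> (1 + a * (t - 1)) / c" using A B AB rhs by linarith
      then show ?thesis using c by (simp add: le_divide_eq)
    qed
    moreover have "t = 1" if "c = 1 + a * (t - 1)"
    proof -
      have "(1 - a) * ln (1 / c) = (1 - a) * (1 / c - 1)"
      proof -
        have "(1 + a * (t - 1)) / c - 1 = 0" using c that by simp
        then show ?thesis using A B AB rhs by linarith
      qed
      then have "ln (1 / c) = 1 / c - 1" using assms by simp
      then have "1 / c = 1" using c by (intro ln_eq_minus_one) auto
      then have "a * (t - 1) = 0" using that by simp
      then show ?thesis using assms by simp
    qed
    ultimately show ?thesis by (simp add: c_def)
  qed
  then show "t powr a \<le> 1 + a * (t - 1)" "t powr a = 1 + a * (t - 1) \<Longrightarrow> t = 1" by auto
qed

text \<open>This is \<open>ln x \<le> x - 1\<close> at \<open>x = 1 / (n * w)\<close>, multiplied by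
  \<open>w\<close>. The lower bound \<open>w - 1 / n\<close> is chosen because it sums to 0 over a
  probability vector of length \<open>n\<close>.\<close>

lemma mult_ln_ge:
  fixes w :: real
  assumes "0 \<le> w" "0 < n"
  shows "w - 1 / n \<le> w * ln (n * w)"
    and "w * ln (n * w) = w - 1 / n \<Longrightarrow> w = 1 / n"
proof -
  have "w - 1 / n \<le> w * ln (n * w) \<and> (w * ln (n * w) = w - 1 / n \<longrightarrow> w = 1 / n)"
  proof (cases "w = 0")
    case True
    then show ?thesis using assms by auto
  next
    case False
    then have w: "w > 0" using assms by simp
    have l: "ln (1 / (n * w)) = - ln (n * w)" using w assms by (simp add: ln_div)
    have "ln (1 / (n * w)) \<le> 1 / (n * w) - 1"
      using w assms by (intro ln_le_minus_one) auto
    then have "w * (1 - 1 / (n * w)) \<le> w * ln (n * w)"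
      using w l by (intro mult_left_mono) auto
    moreover have e: "w * (1 - 1 / (n * w)) = w - 1 / n"
      using w assms by (simp add: field_simps)
    moreover have "w = 1 / n" if "w * ln (n * w) = w - 1 / n"
    proof -
      have "w * ln (n * w) = w * (1 - 1 / (n * w))" using that e by simp
      then have "ln (n * w) = 1 - 1 / (n * w)"
        using w by (metis mult_cancel_left less_irrefl)
      then have "ln (1 / (n * w)) = 1 / (n * w) - 1" using l by simp
      then have "1 / (n * w) = 1" using w assms by (intro ln_eq_minus_one) auto
      then show ?thesis using w assms by (simp add: field_simps)
    qed
    ultimately show ?thesis by simp
  qed
  then show "w - 1 / n \<le> w * ln (n * w)" "w * ln (n * w) = w - 1 / n \<Longrightarrow> w = 1 / n" by auto
qed

section \<open>The divergence of order 0\<close>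

text \<open>A nonzero weight contributes \<open>w l powr a\<close>, which tends to 1, while a zero
  weight contributes \<open>0 powr a = 0\<close> for every \<open>a\<close>. So the limit is minus
  the logarithm of the fraction of nonzero weights. If all weights vanish, both sides are 0 because
  \<open>ln 0 = 0\<close>.\<close>

lemma renyi_formula_tendsto_0:
  assumes nonneg: "\<And>l. l \<in> {1..n} \<Longrightarrow> 0 \<le> w l"
  shows "((\<lambda>a. renyi_formula a n w) \<longlongrightarrow> - ln (\<Sum>l=1..n. if w l = 0 then 0 else 1 / real n)) (at_right 0)"
proof (cases "\<forall>l\<in>{1..n}. w l = 0")
  case True
  then have "renyi_formula a n w = 0" for a by (simp add: renyi_formula_def)
  then show ?thesis using True by simp
next
  case False
  then obtain l0 where l0: "l0 \<in> {1..n}" "w l0 \<noteq> 0" by auto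
  then have n: "real n > 0" by auto
  define T where "T = (\<Sum>l=1..n. if w l = 0 then 0 else 1 / real n)"
  have T: "T > 0"
    unfolding T_def using l0 n by (intro sum_pos2[of _ l0]) auto
  have "((\<lambda>a. w l powr a * real n powr (a - 1)) \<longlongrightarrow> (if w l = 0 then 0 else 1 / real n)) (at_right 0)"
    if "l \<in> {1..n}" for l
  proof (cases "w l = 0")
    case False
    have "((\<lambda>a. w l powr a * real n powr (a - 1)) \<longlongrightarrow> w l powr 0 * real n powr (0 - 1)) (at_right 0)"
      using n False by (intro tendsto_intros) auto
    then show ?thesis using False n by (simp add: powr_minus_divide)
  qed simp
  then have "((\<lambda>a. \<Sum>l=1..n. w l powr a * real n powr (a - 1)) \<longlongrightarrow> T) (at_right 0)"
    unfolding T_def by (intro tendsto_sum)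
  then have "((\<lambda>a. 1 / (a - 1) * ln (\<Sum>l=1..n. w l powr a * real n powr (a - 1))) \<longlongrightarrow> 1 / (0 - 1) * ln T) (at_right 0)"
    using T by (intro tendsto_intros) auto
  then show ?thesis by (simp add: renyi_formula_def T_def)
qed

lemma renyi_div_0:
  assumes "\<And>l. l \<in> {1..n} \<Longrightarrow> 0 \<le> w l"
  shows "renyi_div 0 n w = - ln (\<Sum>l=1..n. if w l = 0 then 0 else 1 / real n)"
  using tendsto_Lim[OF _ renyi_formula_tendsto_0[OF assms]] by (simp add: renyi_div_def)

section \<open>Divergence of a probability vector from the uniform one\<close>

locale probability_vector =
  fixes n :: nat and w :: "nat \<Rightarrow> real"
  assumes nonneg: "\<And>l. l \<in> {1..n} \<Longrightarrow> 0 \<le> w l"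
    and total: "(\<Sum>l=1..n. w l) = 1"
begin

lemma n_pos: "real n > 0"
  using total by (cases n) auto

lemma le_1: "l \<in> {1..n} \<Longrightarrow> w l \<le> 1"
  using member_le_sum[of l "{1..n}" w] nonneg total by auto

text \<open>The divergence of order 1 is the \<open>w\<close>-mean of \<open>ln (n * w l)\<close>.
  Taking \<open>c = n\<close> gives the general upper bound; \<open>c\<close> close to 1 serves the
  convergence proof.\<close>

lemma renyi_div_1_le:
  assumes "\<And>l. l \<in> {1..n} \<Longrightarrow> real n * w l \<le> c"
  shows "renyi_div 1 n w \<le> ln c"
proof -
  have "w l * ln (real n * w l) \<le> w l * ln c" if "l \<in> {1..n}" for l
  proof (cases "w l = 0")
    case False
    then have "0 < real n * w l" using nonneg[OF that] n_pos by simp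
    then show ?thesis
      using nonneg[OF that] assms[OF that] by (intro mult_left_mono) auto
  qed simp
  then have "renyi_div 1 n w \<le> (\<Sum>l=1..n. w l * ln c)"
    unfolding renyi_div_def by (auto intro: sum_mono)
  also have "\<dots> = ln c"
    using total by (simp flip: sum_distrib_right)
  finally show ?thesis .
qed

lemma renyi_div_1_le_ln: "renyi_div 1 n w \<le> ln (real n)"
  using le_1 n_pos by (intro renyi_div_1_le) (simp add: mult_left_le)

lemma sum_diff_uniform: "(\<Sum>l=1..n. w l - 1 / real n) = 0"
  using total n_pos by (simp add: sum_subtractf)

lemma renyi_div_1_nonneg: "0 \<le> renyi_div 1 n w"
proof -
  have "(\<Sum>l=1..n. w l - 1 / real n) \<le> (\<Sum>l=1..n. w l * ln (real n * w l))"
    using nonneg n_pos by (intro sum_mono mult_ln_ge) auto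
  then show ?thesis unfolding sum_diff_uniform by (simp add: renyi_div_def)
qed

text \<open>The gaps in the tangent bound are nonnegative and sum to 0, so each one vanishes and the
  scalar equality case applies.\<close>

lemma renyi_div_1_eq_0:
  assumes "renyi_div 1 n w = 0" "l \<in> {1..n}"
  shows "w l = 1 / real n"
proof -
  have "(\<Sum>l=1..n. w l * ln (real n * w l) - (w l - 1 / real n)) = 0"
    using assms(1) sum_diff_uniform by (simp add: renyi_div_def sum_subtractf)
  then have "w l * ln (real n * w l) - (w l - 1 / real n) = 0"
    using assms(2) nonneg n_pos mult_ln_ge(1)
    by (subst (asm) sum_nonneg_eq_0_iff) auto
  then show ?thesis
    using mult_ln_ge(2)[of "w l" "real n"] nonneg assms(2) n_pos by simp
qed

context
  fixes a :: real
  assumes a: "0 < a" "a < 1"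
begin

text \<open>In this form the Renyi sum is the uniform mean of \<open>(n * w l) powr a\<close>, to
  which the tangent bound at 1 applies.\<close>

lemma renyi_term_eq:
  assumes "l \<in> {1..n}"
  shows "w l powr a * real n powr (a - 1) = (real n * w l) powr a / real n"
  using nonneg[OF assms] n_pos by (simp add: powr_mult powr_diff)

text \<open>The numbers \<open>n * w l\<close> have uniform mean 1, so the linear part of the
  tangents averages to 0.\<close>

lemma renyi_sum_tangent:
  "(\<Sum>l=1..n. (1 + a * (real n * w l - 1)) / real n) = 1"
proof -
  have "(\<Sum>l=1..n. (1 + a * (real n * w l - 1)) / real n) = (\<Sum>l=1..n. (1 - a) / real n + a * w l)"
    using n_pos by (intro sum.cong) (auto simp: field_simps)
  also have "\<dots> = 1"
    using n_pos total by (simp add: sum.distrib flip: sum_distrib_left)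
  finally show ?thesis .
qed

lemma renyi_term_le:
  assumes "l \<in> {1..n}"
  shows "w l powr a * real n powr (a - 1) \<le> (1 + a * (real n * w l - 1)) / real n"
  unfolding renyi_term_eq[OF assms]
  using nonneg[OF assms] n_pos a by (intro divide_right_mono powr_le_tangent) auto

lemma renyi_sum_le_1: "(\<Sum>l=1..n. w l powr a * real n powr (a - 1)) \<le> 1"
  by (rule ord_le_eq_trans[OF sum_mono renyi_sum_tangent]) (rule renyi_term_le)

lemma renyi_sum_eq_1:
  assumes "(\<Sum>l=1..n. w l powr a * real n powr (a - 1)) = 1" "l \<in> {1..n}"
  shows "w l = 1 / real n"
proof -
  have "(\<Sum>l=1..n. (1 + a * (real n * w l - 1)) / real n - w l powr a * real n powr (a - 1)) = 0"
    using assms(1) renyi_sum_tangent by (simp add: sum_subtractf)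
  then have "(1 + a * (real n * w l - 1)) / real n - w l powr a * real n powr (a - 1) = 0"
    using assms(2) renyi_term_le by (subst (asm) sum_nonneg_eq_0_iff) auto
  then have "(real n * w l) powr a = 1 + a * (real n * w l - 1)"
    unfolding renyi_term_eq[OF assms(2)] using n_pos by simp
  then have "real n * w l = 1"
    using nonneg[OF assms(2)] n_pos a by (intro powr_le_tangent(2)) auto
  then show ?thesis using n_pos by (simp add: field_simps)
qed

text \<open>Jensen's inequality for \<open>exp\<close> under the weights \<open>w\<close>: the Renyi
  sum is the \<open>w\<close>-mean of \<open>exp ((a - 1) * ln (n * w l))\<close>, and the mean of
  the exponents is \<open>(a - 1) * renyi_div 1 n w\<close>. Taking logarithms and dividing by the
  negative number \<open>a - 1\<close> yields the comparison with order 1.\<close>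

lemma exp_le_renyi_sum:
  "exp ((a - 1) * renyi_div 1 n w) \<le> (\<Sum>l=1..n. w l powr a * real n powr (a - 1))"
proof -
  define c where "c = (a - 1) * renyi_div 1 n w"
  let ?y = "\<lambda>l. (a - 1) * ln (real n * w l)"
  have "(\<Sum>l=1..n. w l * (1 + (?y l - c))) =
        (\<Sum>l=1..n. w l) + ((a - 1) * (\<Sum>l=1..n. w l * ln (real n * w l)) - c * (\<Sum>l=1..n. w l))"
    by (simp add: algebra_simps sum.distrib sum_subtractf sum_distrib_left)
  also have "\<dots> = 1"
    unfolding total by (simp add: c_def renyi_div_def)
  finally have one: "(\<Sum>l=1..n. w l * (1 + (?y l - c))) = 1" .
  \<comment> \<open>The tangent to \<open>exp\<close> at the mean exponent \<open>c\<close>; by the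
    choice of \<open>c\<close> its \<open>w\<close>-mean is exactly \<open>exp c\<close>.\<close>
  have "exp c * (\<Sum>l=1..n. w l * (1 + (?y l - c))) \<le> exp c * (\<Sum>l=1..n. w l * exp (?y l - c))"
    using nonneg by (intro mult_left_mono sum_mono exp_ge_add_one_self) auto
  also have "\<dots> = (\<Sum>l=1..n. w l * exp (?y l))"
    by (simp add: sum_distrib_left exp_diff)
  also have "\<dots> = (\<Sum>l=1..n. w l powr a * real n powr (a - 1))"
  proof (intro sum.cong refl)
    fix l assume l: "l \<in> {1..n}"
    show "w l * exp (?y l) = w l powr a * real n powr (a - 1)"
    proof (cases "w l = 0")
      case False
      then have w: "w l > 0" using nonneg[OF l] by simp
      then have "exp (?y l) = (real n * w l) powr (a - 1)"
        using n_pos by (simp add: powr_def)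
      also have "\<dots> = w l powr a / w l * real n powr (a - 1)"
        using w n_pos by (simp add: powr_mult powr_diff mult.commute)
      finally show ?thesis using w by simp
    qed simp
  qed
  finally show ?thesis unfolding one by (simp add: c_def)
qed

lemma renyi_sum_pos: "0 < (\<Sum>l=1..n. w l powr a * real n powr (a - 1))"
  using exp_le_renyi_sum by (rule less_le_trans[OF exp_gt_zero])

lemma renyi_formula_nonneg: "0 \<le> renyi_formula a n w"
  unfolding renyi_formula_def using a renyi_sum_pos renyi_sum_le_1
  by (intro mult_nonpos_nonpos) auto

lemma renyi_formula_le: "renyi_formula a n w \<le> renyi_div 1 n w"
proof -
  have "(a - 1) * renyi_div 1 n w \<le> ln (\<Sum>l=1..n. w l powr a * real n powr (a - 1))"
    using exp_le_renyi_sum renyi_sum_pos by (simp add: ln_ge_iff)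
  then show ?thesis using a by (simp add: renyi_formula_def divide_le_eq algebra_simps)
qed

lemma renyi_formula_eq_0:
  assumes "renyi_formula a n w = 0" "l \<in> {1..n}"
  shows "w l = 1 / real n"
  using assms a renyi_sum_pos renyi_sum_eq_1 by (auto simp: renyi_formula_def)

end

lemma renyi_div_bounds:
  assumes "a \<in> {0..1}"
  shows "0 \<le> renyi_div a n w" and "renyi_div a n w \<le> renyi_div 1 n w"
proof -
  have "0 \<le> renyi_div a n w \<and> renyi_div a n w \<le> renyi_div 1 n w"
  proof (cases "a = 0")
    case True
    \<comment> \<open>Order 0 is reached only as a limit, so the bounds known for orders strictly
      between 0 and 1 are passed to it.\<close>
    have lim: "((\<lambda>a. renyi_formula a n w) \<longlongrightarrow> renyi_div 0 n w) (at_right 0)"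
      using renyi_formula_tendsto_0[OF nonneg] renyi_div_0[OF nonneg] by simp
    have ev: "\<forall>\<^sub>F a in at_right (0::real). 0 < a \<and> a < 1"
      by (auto simp: eventually_at_right_field intro: exI[of _ 1])
    show ?thesis unfolding True
      using tendsto_lowerbound[OF lim eventually_mono[OF ev]]
        tendsto_upperbound[OF lim eventually_mono[OF ev]]
        renyi_formula_nonneg renyi_formula_le by auto
  next
    case False
    then show ?thesis
      using assms renyi_div_1_nonneg renyi_formula_nonneg[of a] renyi_formula_le[of a]
      by (cases "a = 1") (auto simp: renyi_div_def[of a])
  qed
  then show "0 \<le> renyi_div a n w" "renyi_div a n w \<le> renyi_div 1 n w" by auto
qed

text \<open>Order 0 is excluded because that divergence sees only which weights vanish: it is 0 as
  soon as all weights are positive.\<close>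

lemma renyi_div_eq_0_iff:
  assumes "a \<in> {0<..1}"
  shows "renyi_div a n w = 0 \<longleftrightarrow> (\<forall>l\<in>{1..n}. w l = 1 / real n)"
proof
  assume "renyi_div a n w = 0"
  then show "\<forall>l\<in>{1..n}. w l = 1 / real n"
    using assms renyi_div_1_eq_0 renyi_formula_eq_0[of a]
    by (cases "a = 1") (auto simp: renyi_div_def[of a])
next
  assume u: "\<forall>l\<in>{1..n}. w l = 1 / real n"
  have "renyi_div 1 n w = 0" using u n_pos by (simp add: renyi_div_def)
  then show "renyi_div a n w = 0"
    using renyi_div_bounds[of a] assms by auto
qed

lemma renyi_div_uniform:
  assumes "a \<in> {0..1}" "\<forall>l\<in>{1..n}. w l = 1 / real n"
  shows "renyi_div a n w = 0"
  using renyi_div_bounds[OF assms(1)] renyi_div_eq_0_iff[of 1] assms(2) by auto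

end

section \<open>Equality of weighted sums of Dirac measures\<close>

lemma emeasure_weighted_diracs:
  assumes "B \<in> sets borel"
  shows "emeasure (weighted_diracs n w x) B = (\<Sum>l\<in>{l\<in>{1..n}. x l \<in> B}. ennreal (w l))"
proof -
  have x: "x \<in> measurable (point_measure {1..n} (\<lambda>l. ennreal (w l))) borel"
    by (simp add: measurable_point_measure_eq1)
  have "x -` B \<inter> {1..n} = {l\<in>{1..n}. x l \<in> B}" by auto
  then show ?thesis unfolding weighted_diracs_def
    using assms x by (simp add: emeasure_distr space_point_measure emeasure_point_measure_finite del: atLeastAtMost_iff)
qed

text \<open>The points may coincide, so the weights are recovered from the image measure only because equal
  points carry equal weights.\<close>

lemma weighted_diracs_eq_iff:
  assumes pos: "\<And>l. l \<in> {1..n} \<Longrightarrow> 0 \<le> w l" "\<And>l. l \<in> {1..n} \<Longrightarrow> 0 \<le> v l"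
    and fib: "\<And>i j. i \<in> {1..n} \<Longrightarrow> j \<in> {1..n} \<Longrightarrow> x i = x j \<Longrightarrow> w i = w j \<and> v i = v j"
  shows "weighted_diracs n w x = weighted_diracs n v x \<longleftrightarrow> (\<forall>l\<in>{1..n}. w l = v l)"
proof
  assume eq: "weighted_diracs n w x = weighted_diracs n v x"
  show "\<forall>l\<in>{1..n}. w l = v l"
  proof
    fix l assume l: "l \<in> {1..n}"
    \<comment> \<open>The fibre of \<open>x\<close> over the point \<open>x l\<close>. Each measure
      gives that point \<open>card J\<close> times the common weight, and \<open>card J > 0\<close>
      cancels.\<close>
    define J where "J = {i\<in>{1..n}. x i \<in> {x l}}"
    have J: "finite J" "l \<in> J" "J \<subseteq> {1..n}" using l by (auto simp: J_def)
    have J_sum: "(\<Sum>i\<in>J. ennreal (u i)) = emeasure (weighted_diracs n u x) {x l}" for u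
      unfolding J_def by (rule emeasure_weighted_diracs[symmetric]) simp
    have "(\<Sum>i\<in>J. ennreal (w i)) = (\<Sum>i\<in>J. ennreal (v i))"
      unfolding J_sum eq ..
    moreover have "(\<Sum>i\<in>J. ennreal (u i)) = ennreal (real (card J) * u l)"
      if pos: "\<And>i. i \<in> {1..n} \<Longrightarrow> 0 \<le> u i" and const: "\<And>i. i \<in> J \<Longrightarrow> u i = u l" for u
    proof -
      have "(\<Sum>i\<in>J. ennreal (u i)) = (\<Sum>i\<in>J. ennreal (u l))"
        by (intro sum.cong refl) (simp add: const)
      then show ?thesis using pos[OF l] by (simp add: ennreal_mult' flip: ennreal_of_nat_eq_real_of_nat)
    qed
    note this[of w] this[of v]
    moreover have "w i = w l" "v i = v l" if "i \<in> J" for i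
      using fib[of i l] l that by (auto simp: J_def)
    ultimately have "ennreal (real (card J) * w l) = ennreal (real (card J) * v l)"
      using pos by simp
    moreover have "card J > 0" using J card_gt_0_iff by blast
    ultimately show "w l = v l" using pos l by simp
  qed
next
  assume "\<forall>l\<in>{1..n}. w l = v l"
  then have "point_measure {1..n} (\<lambda>l. ennreal (w l)) = point_measure {1..n} (\<lambda>l. ennreal (v l))"
    unfolding point_measure_def by (intro density_cong) (auto simp: AE_count_space)
  then show "weighted_diracs n w x = weighted_diracs n v x"
    by (simp add: weighted_diracs_def)
qed

section \<open>Importance weights and the pointwise claims\<close>

lemma unnormalized_weight_nonneg:
  assumes "prob_density f" "prob_density (q (k - 1) \<omega>)"
  shows "0 \<le> unnormalized_weight f q X k l \<omega>"
  using assms by (auto simp: prob_density_def unnormalized_weight_def)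

lemma weight_nonneg:
  assumes "prob_density f" "prob_density (q (k - 1) \<omega>)"
  shows "0 \<le> weight f q m X k l \<omega>"
  unfolding weight_def by (intro divide_nonneg_nonneg sum_nonneg unnormalized_weight_nonneg[where q = q, OF assms])

lemma probability_vector_weight:
  assumes "prob_density f" "prob_density (q (k - 1) \<omega>)" "weights_defined f q m X k \<omega>"
  shows "probability_vector (m k) (\<lambda>l. weight f q m X k l \<omega>)"
proof
  show "0 \<le> weight f q m X k l \<omega>" for l by (rule weight_nonneg[where q = q, OF assms(1,2)])
  obtain l where "l \<in> {1..m k}" "unnormalized_weight f q X k l \<omega> \<noteq> 0"
    using assms(3) by (auto simp: weights_defined_def)
  then have "0 < (\<Sum>j=1..m k. unnormalized_weight f q X k j \<omega>)"
    using unnormalized_weight_nonneg[where f = f and q = q and X = X, OF assms(1,2)]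
    by (intro sum_pos2[of _ l]) (auto simp: less_le)
  then show "(\<Sum>l=1..m k. weight f q m X k l \<omega>) = 1"
    by (simp add: weight_def flip: sum_divide_distrib)
qed

context adaptive_importance_sampling
begin

lemma reg_param_props:
  assumes "\<omega> \<in> space M" "k \<ge> 1" "weights_defined f q m X k \<omega>" "a \<in> {0..1}"
  shows "0 \<le> reg_param f q m X k 1 \<omega>"
    and "reg_param f q m X k 1 \<omega> \<le> reg_param f q m X k a \<omega>"
    and "reg_param f q m X k a \<omega> \<le> 1"
    and "reweighted_dist f q m X k \<omega> = uniform_dist m X k \<omega> \<Longrightarrow> reg_param f q m X k a \<omega> = 1"
    and "a \<noteq> 0 \<Longrightarrow> reg_param f q m X k a \<omega> = 1 \<Longrightarrow> reweighted_dist f q m X k \<omega> = uniform_dist m X k \<omega>"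
proof -
  interpret probability_vector "m k" "\<lambda>l. weight f q m X k l \<omega>"
    using target proposal_density[OF assms(1)] assms(3) by (rule probability_vector_weight)
  have ln: "ln (real (m k)) > 0" using batch_size[OF assms(2)] by simp
  have eq: "reweighted_dist f q m X k \<omega> = uniform_dist m X k \<omega> \<longleftrightarrow>
      (\<forall>l\<in>{1..m k}. weight f q m X k l \<omega> = 1 / real (m k))"
    unfolding reweighted_dist_def uniform_dist_def
  proof (rule weighted_diracs_eq_iff)
    \<comment> \<open>A weight depends on its index only through the sample point, so coinciding
      samples have equal weights.\<close>
    show "weight f q m X k i \<omega> = weight f q m X k j \<omega> \<and> 1 / real (m k) = 1 / real (m k)"
      if "X k i \<omega> = X k j \<omega>" for i j
      using that by (simp add: weight_def unnormalized_weight_def)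
  qed (simp_all add: nonneg)
  show "0 \<le> reg_param f q m X k 1 \<omega>"
    using renyi_div_1_le_ln ln by (simp add: reg_param_def)
  show "reg_param f q m X k 1 \<omega> \<le> reg_param f q m X k a \<omega>" "reg_param f q m X k a \<omega> \<le> 1"
    using renyi_div_bounds[OF assms(4)] ln by (auto simp: reg_param_def divide_right_mono)
  show "reg_param f q m X k a \<omega> = 1" if "reweighted_dist f q m X k \<omega> = uniform_dist m X k \<omega>"
    using that eq renyi_div_uniform[OF assms(4)] by (simp add: reg_param_def)
  show "reweighted_dist f q m X k \<omega> = uniform_dist m X k \<omega>"
    if "a \<noteq> 0" "reg_param f q m X k a \<omega> = 1"
    using that eq renyi_div_eq_0_iff[of a] assms(4) ln by (auto simp: reg_param_def)
qed

section \<open>Measurability and integrability\<close>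

lemma measurable_F_M: "g \<in> measurable (F k) N \<Longrightarrow> g \<in> measurable M N"
  using measurable_from_subalg[OF subalgebra_F] .

lemma f_measurable [measurable]: "f \<in> borel_measurable borel"
  and f_nonneg: "0 \<le> f x"
  and f_total: "(\<integral>\<^sup>+x. ennreal (f x) \<partial>lborel) = 1"
  using target by (auto simp: prob_density_def)

lemma q_nonneg: "\<omega> \<in> space M \<Longrightarrow> 0 \<le> q k \<omega> x"
  and q_total: "\<omega> \<in> space M \<Longrightarrow> (\<integral>\<^sup>+x. ennreal (q k \<omega> x) \<partial>lborel) = 1"
  using proposal_density by (auto simp: prob_density_def)

text \<open>\<open>F k\<close> is a subalgebra of \<open>M\<close> on the same space. Composition
  with this identity turns joint measurability over \<open>F k\<close> into joint measurability over
  \<open>M\<close>.\<close>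

lemma id_measurable_F: "(\<lambda>p. p) \<in> measurable (M \<Otimes>\<^sub>M borel) (F k \<Otimes>\<^sub>M borel)"
proof -
  have "(\<lambda>p. (fst p, snd p)) \<in> measurable (M \<Otimes>\<^sub>M borel) (F k \<Otimes>\<^sub>M borel)"
    by (intro measurable_Pair measurable_compose[OF measurable_fst measurable_F_M[of "\<lambda>x. x" k]])
      simp_all
  then show ?thesis by simp
qed

lemma q_measurable [measurable]: "(\<lambda>p. q k (fst p) (snd p)) \<in> borel_measurable (M \<Otimes>\<^sub>M borel)"
  using measurable_compose[OF id_measurable_F proposal_adapted[of k]] by (simp add: case_prod_beta)

lemma X_measurable: "k \<ge> 1 \<Longrightarrow> l \<in> {1..m k} \<Longrightarrow> X k l \<in> borel_measurable M"
  using measurable_F_M sample_adapted by blast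

lemma unnormalized_weight_measurable:
  assumes "k \<ge> 1" "l \<in> {1..m k}"
  shows "unnormalized_weight f q X k l \<in> borel_measurable M"
proof -
  note [measurable] = X_measurable[OF assms]
  have "(\<lambda>\<omega>. q (k - 1) \<omega> (X k l \<omega>)) \<in> borel_measurable M"
    using measurable_compose[OF _ q_measurable, of "\<lambda>\<omega>. (\<omega>, X k l \<omega>)" M "k - 1"] by simp
  then show ?thesis unfolding unnormalized_weight_def by simp
qed

lemma weight_measurable:
  assumes "k \<ge> 1" "l \<in> {1..m k}"
  shows "weight f q m X k l \<in> borel_measurable M"
  unfolding weight_def using unnormalized_weight_measurable assms
  by (intro borel_measurable_divide borel_measurable_sum) auto

lemma reg_param_measurable:
  assumes "k \<ge> 1"
  shows "reg_param f q m X k a \<in> borel_measurable M"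
proof -
  let ?W = "\<lambda>\<omega> l. weight f q m X k l \<omega>"
  have W [measurable]: "(\<lambda>\<omega>. ?W \<omega> l) \<in> borel_measurable M" if "l \<in> {1..m k}" for l
    using weight_measurable[OF assms that] by simp
  have "(\<lambda>\<omega>. renyi_div a (m k) (?W \<omega>)) \<in> borel_measurable M"
  proof (cases "a = 0")
    case True
    \<comment> \<open>The closed form replaces the limit in the definition. It rests on
      nonnegativity alone, so it also covers outcomes whose weights are all zero.\<close>
    have "renyi_div 0 (m k) (?W \<omega>) = - ln (\<Sum>l=1..m k. if ?W \<omega> l = 0 then 0 else 1 / real (m k))"
      if "\<omega> \<in> space M" for \<omega>
      by (rule renyi_div_0) (rule weight_nonneg[where q = q, OF target proposal_density[OF that]])
    moreover have "(\<lambda>\<omega>. - ln (\<Sum>l=1..m k. if ?W \<omega> l = 0 then 0 else 1 / real (m k))) \<in> borel_measurable M"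
      by (intro borel_measurable_uminus borel_measurable_ln borel_measurable_sum) measurable
    ultimately show ?thesis unfolding True by (subst measurable_cong) auto
  next
    case False
    show ?thesis
    proof (cases "a = 1")
      case True
      show ?thesis unfolding True renyi_div_def if_True simp_thms
        by (intro borel_measurable_sum) measurable
    next
      case False
      have "(\<lambda>\<omega>. (\<Sum>l=1..m k. ?W \<omega> l powr a * real (m k) powr (a - 1))) \<in> borel_measurable M"
        by (intro borel_measurable_sum) measurable
      then show ?thesis using False \<open>a \<noteq> 0\<close> by (simp add: renyi_div_def renyi_formula_def)
    qed
  qed
  then show ?thesis unfolding reg_param_def by simp
qed

lemma reg_param_integrable:
  assumes "k \<ge> 1" "a \<in> {0..1}"
  shows "integrable M (reg_param f q m X k a)"
proof (rule integrable_const_bound[where B = 1])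
  show "AE \<omega> in M. norm (reg_param f q m X k a \<omega>) \<le> 1"
    using weights_nonzero AE_space
  proof eventually_elim
    case (elim \<omega>)
    then have "weights_defined f q m X k \<omega>" using assms(1) by blast
    from reg_param_props(1-3)[OF elim(2) assms(1) this assms(2)] show ?case by simp
  qed
qed (rule reg_param_measurable[OF assms(1)])

section \<open>Joint law of the past and one sample\<close>

text \<open>The weight depends on the outcome through the sample and through the random proposal, so
  the sample is needed jointly with the past. Both sides are measures in \<open>G\<close> that agree
  on rectangles by \<open>batch\<close>, and rectangles form an intersection-stable
  generator.\<close>

lemma sample_joint_law:
  assumes k: "k \<ge> 1" and l: "l \<in> {1..m k}" and G: "G \<in> sets (F (k - 1) \<Otimes>\<^sub>M borel)"
  shows "emeasure M {\<omega> \<in> space M. (\<omega>, X k l \<omega>) \<in> G} =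
    (\<integral>\<^sup>+p. ennreal (q (k - 1) (fst p) (snd p)) * indicator G p \<partial>(M \<Otimes>\<^sub>M lborel))"
proof -
  let ?S = "F (k - 1) \<Otimes>\<^sub>M (borel :: (real ^ 'd) measure)"
  let ?Q = "\<lambda>p. ennreal (q (k - 1) (fst p) (snd p))"
  let ?E = "{A \<times> B | A B. A \<in> sets (F (k - 1)) \<and> B \<in> sets (borel :: (real ^ 'd) measure)}"
  define N1 where "N1 = distr M ?S (\<lambda>\<omega>. (\<omega>, X k l \<omega>))"
  \<comment> \<open>The identity map restricts the measure with density \<open>?Q\<close> to the
    smaller sigma-algebra of the past, where uniqueness is applied.\<close>
  define N2 where "N2 = distr (density (M \<Otimes>\<^sub>M lborel) ?Q) ?S (\<lambda>p. p)"
  have cong: "sets (M \<Otimes>\<^sub>M lborel) = sets (M \<Otimes>\<^sub>M (borel :: (real ^ 'd) measure))"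
    by (intro sets_pair_measure_cong) auto
  have Q [measurable]: "?Q \<in> borel_measurable (M \<Otimes>\<^sub>M lborel)"
    unfolding measurable_cong_sets[OF cong refl] by measurable
  have m1: "(\<lambda>\<omega>. (\<omega>, X k l \<omega>)) \<in> measurable M ?S"
    by (rule measurable_Pair[OF measurable_F_M[OF measurable_ident_sets[OF refl]] X_measurable[OF k l]])
  have m2: "(\<lambda>p. p) \<in> measurable (density (M \<Otimes>\<^sub>M lborel) ?Q) ?S"
    using id_measurable_F[of "k - 1"] by (simp add: measurable_cong_sets[OF cong refl])
  have N1: "emeasure N1 G = emeasure M {\<omega> \<in> space M. (\<omega>, X k l \<omega>) \<in> G}" if "G \<in> sets ?S" for G
    unfolding N1_def using that m1
    by (subst emeasure_distr) (auto intro!: arg_cong[where f = "emeasure M"])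
  have sets_le: "G \<in> sets (M \<Otimes>\<^sub>M lborel)" if "G \<in> sets ?S" for G
  proof -
    have "(\<lambda>p. p) -` G \<inter> space (M \<Otimes>\<^sub>M (borel :: (real ^ 'd) measure)) = G"
      using sets.sets_into_space[OF that] by (auto simp: space_pair_measure space_F)
    then show ?thesis using measurable_sets[OF id_measurable_F that] cong by simp
  qed
  have N2: "emeasure N2 G = (\<integral>\<^sup>+p. ?Q p * indicator G p \<partial>(M \<Otimes>\<^sub>M lborel))" if "G \<in> sets ?S" for G
  proof -
    have "(\<lambda>p. p) -` G \<inter> space (density (M \<Otimes>\<^sub>M lborel) ?Q) = G"
      using sets.sets_into_space[OF that] by (auto simp: space_pair_measure space_F)
    then show ?thesis
      unfolding N2_def using that m2 sets_le[OF that] by (simp add: emeasure_distr emeasure_density)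
  qed
  have "N1 = N2"
  proof (rule measure_eqI_generator_eq[where E = ?E and \<Omega> = "space M \<times> UNIV" and A = "\<lambda>_. space M \<times> UNIV"])
    show "Int_stable ?E" by (rule Int_stable_pair_measure_generator)
    show "?E \<subseteq> Pow (space M \<times> UNIV)"
      using sets.sets_into_space[where M = "F (k - 1)"] unfolding space_F by blast
    show "sets N1 = sigma_sets (space M \<times> UNIV) ?E" "sets N2 = sigma_sets (space M \<times> UNIV) ?E"
      by (simp_all add: N1_def N2_def sets_pair_measure space_F)
    show "range (\<lambda>_. space M \<times> UNIV) \<subseteq> ?E"
      using sets.top[of "F (k - 1)"] unfolding space_F by force
    show "(\<Union>i::nat. space M \<times> UNIV) = space M \<times> (UNIV :: (real ^ 'd) set)" by simp
    have "prob_space N1" unfolding N1_def by (rule prob_space_distr[OF m1])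
    then interpret N1: prob_space N1 .
    show "emeasure N1 (space M \<times> UNIV) \<noteq> \<infinity>" by simp
    fix G assume "G \<in> ?E"
    then obtain A B where G: "G = A \<times> B" "A \<in> sets (F (k - 1))" "B \<in> sets borel" by auto
    have A: "A \<subseteq> space M" using sets.sets_into_space[OF G(2)] by (simp add: space_F)
    have GS: "G \<in> sets ?S" using G by simp
    \<comment> \<open>Only sample \<open>l\<close> is constrained; every other factor of the product
      in \<open>batch\<close> is the total mass 1 of the proposal.\<close>
    define B' where "B' = (\<lambda>j. if j = l then B else UNIV)"
    have "emeasure N1 G = emeasure M {\<omega> \<in> A. \<forall>j\<in>{1..m k}. X k j \<omega> \<in> B' j}"
      unfolding N1[OF GS] using A l
      by (intro arg_cong[where f = "emeasure M"]) (auto simp: B'_def G)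
    also have "\<dots> = (\<integral>\<^sup>+\<omega>\<in>A. (\<Prod>j=1..m k. \<integral>\<^sup>+x\<in>B' j. ennreal (q (k - 1) \<omega> x) \<partial>lborel) \<partial>M)"
      using G by (subst batch[OF k]) (auto simp: B'_def)
    also have "\<dots> = (\<integral>\<^sup>+\<omega>. \<integral>\<^sup>+x. ?Q (\<omega>, x) * indicator G (\<omega>, x) \<partial>lborel \<partial>M)"
    proof (intro nn_integral_cong)
      fix \<omega> assume \<omega>: "\<omega> \<in> space M"
      have "(\<Prod>j=1..m k. \<integral>\<^sup>+x\<in>B' j. ennreal (q (k - 1) \<omega> x) \<partial>lborel) =
            (\<Prod>j=1..m k. if j = l then \<integral>\<^sup>+x\<in>B. ennreal (q (k - 1) \<omega> x) \<partial>lborel else 1)"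
        using q_total[OF \<omega>] by (intro prod.cong) (auto simp: B'_def)
      also have "\<dots> = (\<integral>\<^sup>+x\<in>B. ennreal (q (k - 1) \<omega> x) \<partial>lborel)"
        using l by (simp add: prod.delta)
      finally show "(\<Prod>j=1..m k. \<integral>\<^sup>+x\<in>B' j. ennreal (q (k - 1) \<omega> x) \<partial>lborel) * indicator A \<omega> =
          (\<integral>\<^sup>+x. ?Q (\<omega>, x) * indicator G (\<omega>, x) \<partial>lborel)"
        by (cases "\<omega> \<in> A") (simp_all add: G indicator_times)
    qed
    also have "\<dots> = emeasure N2 G"
      unfolding N2[OF GS]
      by (intro lborel.nn_integral_fst borel_measurable_times_ennreal borel_measurable_indicator Q sets_le GS)
    finally show "emeasure N1 G = emeasure N2 G" .
  qed
  then show ?thesis using N1[OF G] N2[OF G] by simp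
qed

text \<open>Markov's inequality under the joint law: on the deviation event
  \<open>q * e \<le> q * \<bar>f / q - 1\<bar> = \<bar>q - f\<bar>\<close>.\<close>

lemma emeasure_weight_deviation:
  assumes k: "k \<ge> 1" and l: "l \<in> {1..m k}" and e: "e > 0"
  shows "emeasure M {\<omega> \<in> space M. \<bar>unnormalized_weight f q X k l \<omega> - 1\<bar> > e} \<le>
    ennreal (1 / e) * (\<integral>\<^sup>+p. ennreal (norm (q (k - 1) (fst p) (snd p) - f (snd p))) \<partial>(M \<Otimes>\<^sub>M lborel))"
proof -
  let ?S = "F (k - 1) \<Otimes>\<^sub>M (borel :: (real ^ 'd) measure)"
  let ?q = "\<lambda>p. q (k - 1) (fst p) (snd p)"
  define G where "G = {p \<in> space ?S. \<bar>f (snd p) / ?q p - 1\<bar> > e}"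
  have [measurable]: "?q \<in> borel_measurable ?S"
    using proposal_adapted[of "k - 1"] by (simp add: case_prod_beta)
  have G: "G \<in> sets ?S" unfolding G_def by measurable
  have cong: "sets (M \<Otimes>\<^sub>M lborel) = sets (M \<Otimes>\<^sub>M (borel :: (real ^ 'd) measure))"
    by (intro sets_pair_measure_cong) auto
  have [measurable]: "(\<lambda>p. ennreal (norm (?q p - f (snd p)))) \<in> borel_measurable (M \<Otimes>\<^sub>M lborel)"
    unfolding measurable_cong_sets[OF cong refl] by measurable
  have "emeasure M {\<omega> \<in> space M. \<bar>unnormalized_weight f q X k l \<omega> - 1\<bar> > e} =
        emeasure M {\<omega> \<in> space M. (\<omega>, X k l \<omega>) \<in> G}"
    by (intro arg_cong[where f = "emeasure M"])
      (auto simp: G_def unnormalized_weight_def space_pair_measure space_F)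
  also have "\<dots> = (\<integral>\<^sup>+p. ennreal (?q p) * indicator G p \<partial>(M \<Otimes>\<^sub>M lborel))"
    by (rule sample_joint_law[OF k l G])
  also have "\<dots> \<le> (\<integral>\<^sup>+p. ennreal (1 / e) * ennreal (norm (?q p - f (snd p))) \<partial>(M \<Otimes>\<^sub>M lborel))"
  proof (rule nn_integral_mono)
    fix p assume "p \<in> space (M \<Otimes>\<^sub>M (lborel :: (real ^ 'd) measure))"
    then have q0: "0 \<le> ?q p" by (auto simp: space_pair_measure intro: q_nonneg)
    show "ennreal (?q p) * indicator G p \<le> ennreal (1 / e) * ennreal (norm (?q p - f (snd p)))"
    \<comment> \<open>Where the proposal vanishes the left side is 0, so the value of
      \<open>f / 0\<close> does no harm.\<close>
    proof (cases "p \<in> G \<and> ?q p \<noteq> 0")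
      case True
      then have q: "?q p > 0" and "e < \<bar>f (snd p) / ?q p - 1\<bar>" using q0 by (auto simp: G_def)
      then have "?q p * e \<le> ?q p * \<bar>f (snd p) / ?q p - 1\<bar>" by simp
      also have "\<dots> = \<bar>?q p * (f (snd p) / ?q p - 1)\<bar>" using q by (simp add: abs_mult)
      also have "\<dots> = \<bar>?q p - f (snd p)\<bar>" using q by (simp add: right_diff_distrib abs_minus_commute)
      finally have "?q p \<le> 1 / e * norm (?q p - f (snd p))" using e by (simp add: field_simps)
      then show ?thesis using True e by (simp add: ennreal_leI flip: ennreal_mult)
    qed auto
  qed
  also have "\<dots> = ennreal (1 / e) * (\<integral>\<^sup>+p. ennreal (norm (?q p - f (snd p))) \<partial>(M \<Otimes>\<^sub>M lborel))"
    by (rule nn_integral_cmult) measurable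
  finally show ?thesis .
qed

section \<open>Convergence in mean\<close>

text \<open>Scheffe's lemma on the product of \<open>M\<close> and Lebesgue measure. There
  \<open>f\<close> and all proposals have integral 1, since \<open>M\<close> is a probability
  measure.\<close>

lemma proposal_L1_convergence:
  assumes "AE \<omega> in M. AE x in lborel. (\<lambda>k. \<bar>q k \<omega> x - f x\<bar>) \<longlonglongrightarrow> 0"
  shows "(\<lambda>k. \<integral>\<^sup>+p. ennreal (norm (q k (fst p) (snd p) - f (snd p))) \<partial>(M \<Otimes>\<^sub>M lborel)) \<longlonglongrightarrow> 0"
proof (rule Scheffe_lemma2)
  interpret pair_sigma_finite M "lborel :: (real ^ 'd) measure" ..
  have cong: "sets (M \<Otimes>\<^sub>M lborel) = sets (M \<Otimes>\<^sub>M (borel :: (real ^ 'd) measure))"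
    by (intro sets_pair_measure_cong) auto
  show q [measurable]: "(\<lambda>p. q k (fst p) (snd p)) \<in> borel_measurable (M \<Otimes>\<^sub>M lborel)" for k
    unfolding measurable_cong_sets[OF cong refl] by measurable
  have f [measurable]: "(\<lambda>p. f (snd p)) \<in> borel_measurable (M \<Otimes>\<^sub>M lborel)" by measurable
  have If: "(\<integral>\<^sup>+p. ennreal (norm (f (snd p))) \<partial>(M \<Otimes>\<^sub>M lborel)) = 1"
    using f_total f_nonneg emeasure_space_1 by (subst lborel.nn_integral_fst[symmetric]) auto
  show "integrable (M \<Otimes>\<^sub>M lborel) (\<lambda>p. f (snd p))"
    using f If by (simp add: integrable_iff_bounded)
  have "(\<integral>\<^sup>+p. ennreal (norm (q k (fst p) (snd p))) \<partial>(M \<Otimes>\<^sub>M lborel)) = (\<integral>\<^sup>+\<omega>. 1 \<partial>M)" for k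
    by (subst lborel.nn_integral_fst[symmetric]) (auto simp: q_nonneg q_total cong: nn_integral_cong)
  then show "(\<integral>\<^sup>+p. ennreal (norm (q k (fst p) (snd p))) \<partial>(M \<Otimes>\<^sub>M lborel)) \<le>
      (\<integral>\<^sup>+p. ennreal (norm (f (snd p))) \<partial>(M \<Otimes>\<^sub>M lborel))" for k
    using If emeasure_space_1 by simp
  show "AE p in M \<Otimes>\<^sub>M lborel. (\<lambda>k. q k (fst p) (snd p)) \<longlonglongrightarrow> f (snd p)"
  proof (rule AE_pair_measure)
    \<comment> \<open>Subtracting the limit turns this into convergence to a constant, whose set is
      measurable; that is required to lift the iterated almost-everywhere statement to the
      product.\<close>
    have "{p \<in> space (M \<Otimes>\<^sub>M lborel). (\<lambda>k. q k (fst p) (snd p)) \<longlonglongrightarrow> f (snd p)} =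
        {p \<in> space (M \<Otimes>\<^sub>M lborel). (\<lambda>k. q k (fst p) (snd p) - f (snd p)) \<longlonglongrightarrow> 0}"
      by (simp add: LIM_zero_iff)
    also have "\<dots> \<in> sets (M \<Otimes>\<^sub>M lborel)" by measurable
    finally show "{p \<in> space (M \<Otimes>\<^sub>M lborel). (\<lambda>k. q k (fst p) (snd p)) \<longlonglongrightarrow> f (snd p)}
        \<in> sets (M \<Otimes>\<^sub>M lborel)" .
    show "AE \<omega> in M. AE x in lborel. (\<lambda>k. q k (fst (\<omega>, x)) (snd (\<omega>, x))) \<longlonglongrightarrow> f (snd (\<omega>, x))"
      using assms by (simp add: tendsto_rabs_zero_iff LIM_zero_iff)
  qed
qed

text \<open>The normalizing sum is at least \<open>m k * (1 - e)\<close> and each numerator at most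
  \<open>1 + e\<close>, so \<open>m k\<close> times a weight is at most
  \<open>(1 + e) / (1 - e)\<close>. As \<open>m k \<ge> 2\<close>, the denominator
  \<open>ln (m k)\<close> can be replaced by \<open>ln 2\<close>, which makes the bound independent
  of \<open>k\<close>.\<close>

lemma reg_param_near_1:
  assumes "\<omega> \<in> space M" "k \<ge> 1" "weights_defined f q m X k \<omega>" "a \<in> {0..1}"
    and e: "0 < e" "e < 1" and dev: "\<And>l. l \<in> {1..m k} \<Longrightarrow> \<bar>unnormalized_weight f q X k l \<omega> - 1\<bar> \<le> e"
  shows "\<bar>reg_param f q m X k a \<omega> - 1\<bar> \<le> ln ((1 + e) / (1 - e)) / ln 2"
proof -
  interpret probability_vector "m k" "\<lambda>l. weight f q m X k l \<omega>"
    using target proposal_density[OF assms(1)] assms(3) by (rule probability_vector_weight)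
  let ?u = "\<lambda>l. unnormalized_weight f q X k l \<omega>"
  have u: "1 - e \<le> ?u l" "?u l \<le> 1 + e" if "l \<in> {1..m k}" for l
    using dev[OF that] by (simp_all add: abs_le_iff)
  have "(\<Sum>l=1..m k. 1 - e) \<le> (\<Sum>l=1..m k. ?u l)" using u by (intro sum_mono) auto
  then have sum: "real (m k) * (1 - e) \<le> (\<Sum>l=1..m k. ?u l)" by simp
  have "real (m k) * weight f q m X k l \<omega> \<le> (1 + e) / (1 - e)" if "l \<in> {1..m k}" for l
  proof -
    have "weight f q m X k l \<omega> \<le> (1 + e) / (real (m k) * (1 - e))"
      unfolding weight_def using e u[OF that] sum n_pos by (intro frac_le) auto
    then show ?thesis using n_pos e by (simp add: field_simps)
  qed
  then have D: "renyi_div 1 (m k) (\<lambda>l. weight f q m X k l \<omega>) \<le> ln ((1 + e) / (1 - e))"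
    by (rule renyi_div_1_le)
  have pos: "0 < ln (2::real)" "ln 2 \<le> ln (real (m k))" using batch_size[OF assms(2)] by auto
  have "\<bar>reg_param f q m X k a \<omega> - 1\<bar> = renyi_div a (m k) (\<lambda>l. weight f q m X k l \<omega>) / ln (real (m k))"
    using renyi_div_bounds[OF assms(4)] less_le_trans[OF pos] by (simp add: reg_param_def)
  also have "\<dots> \<le> ln ((1 + e) / (1 - e)) / ln 2"
    using renyi_div_bounds[OF assms(4)] pos D by (intro frac_le) auto
  finally show ?thesis .
qed

text \<open>The event \<open>B l\<close> says that weight \<open>l\<close> deviates by more than
  \<open>e\<close>. Outside all of them the near-uniform bound holds; on their union the error is at
  most 1. The union bound over the batch produces the factor \<open>m k\<close>.\<close>

lemma reg_param_L1_bound: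
  assumes k: "k \<ge> 1" and a: "a \<in> {0..1}" and e: "0 < e" "e < 1"
  shows "ennreal (LINT \<omega>|M. \<bar>reg_param f q m X k a \<omega> - 1\<bar>) \<le> ennreal (ln ((1 + e) / (1 - e)) / ln 2) +
    ennreal (real (m k) / e) * (\<integral>\<^sup>+p. ennreal (norm (q (k - 1) (fst p) (snd p) - f (snd p))) \<partial>(M \<Otimes>\<^sub>M lborel))"
proof -
  let ?\<Delta> = "\<integral>\<^sup>+p. ennreal (norm (q (k - 1) (fst p) (snd p) - f (snd p))) \<partial>(M \<Otimes>\<^sub>M lborel)"
  define c where "c = ln ((1 + e) / (1 - e)) / ln 2"
  define B where "B = (\<lambda>l. {\<omega> \<in> space M. \<bar>unnormalized_weight f q X k l \<omega> - 1\<bar> > e})"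
  have B: "B l \<in> sets M" if "l \<in> {1..m k}" for l
    using unnormalized_weight_measurable[OF k that] unfolding B_def by measurable
  have "c \<ge> 0" using e by (simp add: c_def)
  have "ennreal (LINT \<omega>|M. \<bar>reg_param f q m X k a \<omega> - 1\<bar>) = (\<integral>\<^sup>+\<omega>. ennreal \<bar>reg_param f q m X k a \<omega> - 1\<bar> \<partial>M)"
    using reg_param_integrable[OF k a] by (intro nn_integral_eq_integral[symmetric]) auto
  also have "\<dots> \<le> (\<integral>\<^sup>+\<omega>. ennreal c + (\<Sum>l=1..m k. indicator (B l) \<omega>) \<partial>M)"
  proof (rule nn_integral_mono_AE)
    show "AE \<omega> in M. ennreal \<bar>reg_param f q m X k a \<omega> - 1\<bar> \<le> ennreal c + (\<Sum>l=1..m k. indicator (B l) \<omega>)"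
      using weights_nonzero AE_space
    proof eventually_elim
      case (elim \<omega>)
      then have wd: "weights_defined f q m X k \<omega>" and \<omega>: "\<omega> \<in> space M" using k by auto
      show ?case
      proof (cases "\<exists>l\<in>{1..m k}. \<omega> \<in> B l")
        case True
        then obtain l where l: "l \<in> {1..m k}" "\<omega> \<in> B l" by auto
        have "ennreal \<bar>reg_param f q m X k a \<omega> - 1\<bar> \<le> ennreal 1"
          using reg_param_props[OF \<omega> k wd a] by (intro ennreal_leI) auto
        also have "\<dots> = indicator (B l) \<omega>" using l by simp
        also have "\<dots> \<le> (\<Sum>l=1..m k. indicator (B l) \<omega>)" using l by (intro member_le_sum) auto
        also have "\<dots> \<le> ennreal c + (\<Sum>l=1..m k. indicator (B l) \<omega>)" by simp
        finally show ?thesis .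
      next
        case False
        then have "ennreal \<bar>reg_param f q m X k a \<omega> - 1\<bar> \<le> ennreal c"
          unfolding c_def using \<omega> by (intro ennreal_leI reg_param_near_1 k wd a e) (auto simp: B_def not_less)
        then show ?thesis by (rule order_trans) simp
      qed
    qed
  qed
  also have "\<dots> = ennreal c + (\<Sum>l=1..m k. emeasure M (B l))"
    using B emeasure_space_1
    by (simp add: nn_integral_add nn_integral_sum del: atLeastAtMost_iff One_nat_def)
  also have "\<dots> \<le> ennreal c + (\<Sum>l=1..m k. ennreal (1 / e) * ?\<Delta>)"
    unfolding B_def using e by (intro add_left_mono sum_mono emeasure_weight_deviation k) auto
  also have "(\<Sum>l=1..m k. ennreal (1 / e) * ?\<Delta>) = ennreal (real (m k) / e) * ?\<Delta>"
    using e by (simp add: ennreal_of_nat_eq_real_of_nat divide_inverse ennreal_mult mult.assoc)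
  finally show ?thesis unfolding c_def .
qed

lemma reg_param_L1_convergence:
  assumes a: "a \<in> {0..1}"
    and conv: "AE \<omega> in M. AE x in lborel. (\<lambda>k. \<bar>q k \<omega> x - f x\<bar>) \<longlonglongrightarrow> 0"
    and bdd: "Bseq (\<lambda>k. real (m k))"
  shows "(\<lambda>k. LINT \<omega>|M. \<bar>reg_param f q m X k a \<omega> - 1\<bar>) \<longlonglongrightarrow> 0"
proof (rule LIMSEQ_I)
  fix r :: real assume r: "r > 0"
  obtain N where N: "\<And>k. real (m k) \<le> N" using bdd by (auto simp: Bseq_def)
  define \<Delta> where "\<Delta> = (\<lambda>k. \<integral>\<^sup>+p. ennreal (norm (q k (fst p) (snd p) - f (snd p))) \<partial>(M \<Otimes>\<^sub>M lborel))"
  \<comment> \<open>Chosen so that \<open>ln c / ln 2 = r / 2\<close>: half of \<open>r\<close> pays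
    for nearly uniform weights, half for the deviation events. As \<open>e\<close> depends only on
    \<open>r\<close>, it stays fixed while \<open>k\<close> grows.\<close>
  define c where "c = exp (r / 2 * ln 2)"
  define e where "e = (c - 1) / (c + 1)" \<comment> \<open>solves \<open>(1 + e) / (1 - e) = c\<close>\<close>
  have c: "c > 1" using r by (simp add: c_def)
  have e: "0 < e" "e < 1" using c by (auto simp: e_def)
  have "(1 + e) / (1 - e) = c" using c by (simp add: e_def field_simps)
  then have ce: "ln ((1 + e) / (1 - e)) / ln 2 = r / 2" by (simp add: c_def)
  have "(\<lambda>k. ennreal (N / e) * \<Delta> k) \<longlonglongrightarrow> ennreal (N / e) * 0"
    unfolding \<Delta>_def by (intro ennreal_tendsto_cmult proposal_L1_convergence conv) simp
  then have "\<forall>\<^sub>F k in sequentially. ennreal (N / e) * \<Delta> k < ennreal (r / 2)"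
    using r by (intro order_tendstoD(2)[where y = 0]) auto
  then obtain K where K: "\<And>k. k \<ge> K \<Longrightarrow> ennreal (N / e) * \<Delta> k < ennreal (r / 2)"
    by (auto simp: eventually_sequentially)
  \<comment> \<open>Batch \<open>k\<close> is drawn from \<open>q (k - 1)\<close>, so the threshold
    for the proposals shifts by one; \<open>k \<ge> Suc K\<close> also gives
    \<open>k \<ge> 1\<close>.\<close>
  have "norm ((LINT \<omega>|M. \<bar>reg_param f q m X k a \<omega> - 1\<bar>) - 0) < r" if "k \<ge> Suc K" for k
  proof -
    have "ennreal (LINT \<omega>|M. \<bar>reg_param f q m X k a \<omega> - 1\<bar>) \<le> ennreal (r / 2) + ennreal (real (m k) / e) * \<Delta> (k - 1)"
      using reg_param_L1_bound[OF _ a e, of k] that unfolding ce \<Delta>_def by simp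
    also have "\<dots> \<le> ennreal (r / 2) + ennreal (N / e) * \<Delta> (k - 1)"
      using N e by (intro add_left_mono mult_right_mono ennreal_leI divide_right_mono) auto
    also have "\<dots> < ennreal (r / 2) + ennreal (r / 2)"
      using K[of "k - 1"] that by (simp add: ennreal_add_left_cancel_less)
    also have "\<dots> = ennreal r" using r by (simp flip: ennreal_plus)
    finally show ?thesis by (simp add: ennreal_less_iff)
  qed
  then show "\<exists>no. \<forall>k\<ge>no. norm ((LINT \<omega>|M. \<bar>reg_param f q m X k a \<omega> - 1\<bar>) - 0) < r" by blast
qed

end

theorem proposition5:
  fixes M :: "'w measure"
    and F :: "nat \<Rightarrow> 'w measure"
    and f :: "real ^ 'd \<Rightarrow> real"
    and q :: "nat \<Rightarrow> 'w \<Rightarrow> real ^ 'd \<Rightarrow> real"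
    and m :: "nat \<Rightarrow> nat"
    and X :: "nat \<Rightarrow> nat \<Rightarrow> 'w \<Rightarrow> real ^ 'd"
    and \<alpha> :: real
  assumes "adaptive_importance_sampling M F f q m X"
    and "\<alpha> \<in> {0..1}"
  shows
    "(\<forall>\<omega>\<in>space M. \<forall>k\<ge>1. weights_defined f q m X k \<omega> \<longrightarrow>
        reg_param f q m X k \<alpha> \<omega> \<in> {0..1} \<and>
        (reweighted_dist f q m X k \<omega> = uniform_dist m X k \<omega> \<longrightarrow> reg_param f q m X k \<alpha> \<omega> = 1) \<and>
        (\<alpha> \<noteq> 0 \<longrightarrow>
          (reg_param f q m X k \<alpha> \<omega> = 1 \<longleftrightarrow>
           reweighted_dist f q m X k \<omega> = uniform_dist m X k \<omega>))) \<and>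
     (\<forall>\<omega>\<in>space M. \<forall>k\<ge>1. weights_defined f q m X k \<omega> \<longrightarrow>
        0 \<le> reg_param f q m X k 1 \<omega> \<and>
        reg_param f q m X k 1 \<omega> \<le> reg_param f q m X k \<alpha> \<omega> \<and>
        reg_param f q m X k \<alpha> \<omega> \<le> 1) \<and>
     (\<forall>m_lim :: real.
        (AE \<omega> in M. AE x in lborel. (\<lambda>k. \<bar>q k \<omega> x - f x\<bar>) \<longlonglongrightarrow> 0) \<longrightarrow>
        (\<lambda>k. real (m k)) \<longlonglongrightarrow> m_lim \<longrightarrow>
        (\<forall>k\<ge>1. integrable M (reg_param f q m X k \<alpha>)) \<and>
        (\<lambda>k. LINT \<omega>|M. \<bar>reg_param f q m X k \<alpha> \<omega> - 1\<bar>) \<longlonglongrightarrow> 0)"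
proof -
  interpret adaptive_importance_sampling M F f q m X by (rule assms(1))
  \<comment> \<open>A bound on the batch sizes controls the factor \<open>m k\<close> of the union
    bound.\<close>
  have bounded: "Bseq (\<lambda>k. real (m k))" if "(\<lambda>k. real (m k)) \<longlonglongrightarrow> L" for L
    using that by (intro convergent_imp_Bseq convergentI)
  note props = reg_param_props[OF _ _ _ assms(2)]
  have i: "\<forall>\<omega>\<in>space M. \<forall>k\<ge>1. weights_defined f q m X k \<omega> \<longrightarrow>
        reg_param f q m X k \<alpha> \<omega> \<in> {0..1} \<and>
        (reweighted_dist f q m X k \<omega> = uniform_dist m X k \<omega> \<longrightarrow> reg_param f q m X k \<alpha> \<omega> = 1) \<and>
        (\<alpha> \<noteq> 0 \<longrightarrow>
          (reg_param f q m X k \<alpha> \<omega> = 1 \<longleftrightarrow>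
           reweighted_dist f q m X k \<omega> = uniform_dist m X k \<omega>))"
    \<comment> \<open>Nonnegativity at order \<alpha> comes through order 1, where the divergence is
      largest.\<close>
    using order_trans[OF props(1,2)] props(3-5) unfolding atLeastAtMost_iff by blast
  show ?thesis
    using i props(1-3) reg_param_integrable[OF _ assms(2)] reg_param_L1_convergence[OF assms(2) _ bounded]
    by blast
qed

end
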